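(* The Sophie Germain prime numbers are placed in a set of natural numbers with asymptotic density equal to $1/6$; that is, there is a set $S\subseteq\mathbb{N}$ of asymptotic density $1/6$ such that every Sophie Germain prime belongs to $S$.
   Context: $\mathbb{N}=\{0,1,2,\dots\}$. The asymptotic (natural) density of a set $A\subseteq\mathbb{N}$ is $\lim_{n\to\infty} |A\cap\{0,1,\dots,n-1\}|/n$, when this limit exists. A Sophie Germain prime is a prime number $p$ such that $2p+1$ is also prime. *)

theory Defs
  imports Complex_Main "HOL-Computational_Algebra.Primes"
begin

(* The term at n = 0 is 0 / 0 = 0 and does not affect the limit. *)
definition has_asymptotic_density :: "nat set \<Rightarrow> real \<Rightarrow> bool" where
  "has_asymptotic_density A d \<longleftrightarrow>
     (\<lambda>n. real (card (A \<inter> {0..<n})) / real n) \<longlonglongrightarrow> d"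

definition sophie_germain_prime :: "nat \<Rightarrow> bool" where
  "sophie_germain_prime p \<longleftrightarrow> prime p \<and> prime (2 * p + 1)"

end

theory Submission
  imports Defs
begin

text \<open>
  A Sophie Germain prime \<open>p > 3\<close> lies in the residue class \<open>5\<close> modulo \<open>6\<close>: the classes
  \<open>0\<close>, \<open>2\<close>, \<open>3\<close> and \<open>4\<close> contain only multiples of \<open>2\<close> or \<open>3\<close>, and if \<open>p\<close> is congruent
  to \<open>1\<close> modulo \<open>3\<close>, then \<open>3\<close> divides \<open>2 * p + 1\<close>.  Hence the class \<open>5\<close> modulo \<open>6\<close> together
  with the two exceptions \<open>2\<close> and \<open>3\<close> contains all of them.  The counting function of this set
  stays within a bounded distance of \<open>n / 6\<close>, because a residue class modulo \<open>m\<close> takes exactly one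
  element from each block of \<open>m\<close> consecutive numbers and two further elements shift the count by at
  most \<open>2\<close>.  Dividing by \<open>n\<close> makes the error vanish in the limit.
\<close>

lemma has_asymptotic_density_if_bounded_discrepancy:
  assumes discrepancy: "\<And>n. \<bar>real (card (A \<inter> {0..<n})) - d * real n\<bar> \<le> C"
  shows "has_asymptotic_density A d"
  unfolding has_asymptotic_density_def
proof (rule LIM_zero_cancel, rule tendsto_0_le[where K = 1])
  show "(\<lambda>n. C / real n) \<longlonglongrightarrow> 0"
    by (rule lim_const_over_n)
  show "\<forall>\<^sub>F n in sequentially.
          norm (real (card (A \<inter> {0..<n})) / real n - d) \<le> norm (C / real n) * 1"
    using eventually_gt_at_top[of 0]
  proof eventually_elim
    case (elim n)
    then have "real (card (A \<inter> {0..<n})) / real n - d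
                 = (real (card (A \<inter> {0..<n})) - d * real n) / real n"
      by (simp add: field_simps)
    then show ?case
      using discrepancy[of n] by (simp add: divide_right_mono abs_divide)
  qed
qed

text \<open>
  The class of \<open>m - 1\<close> is the one whose counting function needs no offset: each completed block of
  length \<open>m\<close> contributes its last element, and an incomplete block contributes nothing.
\<close>

lemma card_last_residue_class:
  fixes m n :: nat
  assumes "m > 0"
  shows "card ({k. Suc k mod m = 0} \<inter> {0..<n}) = n div m"
proof (induction n)
  case 0
  show ?case by simp
next
  case (Suc n)
  have "{k. Suc k mod m = 0} \<inter> {0..<Suc n} =
          (if Suc n mod m = 0 then insert n ({k. Suc k mod m = 0} \<inter> {0..<n})
           else {k. Suc k mod m = 0} \<inter> {0..<n})"
    by (auto simp: less_Suc_eq)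
  then show ?case
    using Suc.IH by (simp add: div_Suc)
qed

lemma has_asymptotic_density_last_residue_class_Un_finite:
  fixes m :: nat
  assumes "m > 0" and "finite F"
  shows "has_asymptotic_density ({k. Suc k mod m = 0} \<union> F) (1 / real m)"
proof (rule has_asymptotic_density_if_bounded_discrepancy)
  fix n :: nat
  let ?R = "{k. Suc k mod m = 0}"
  have lower: "n div m \<le> card ((?R \<union> F) \<inter> {0..<n})"
    unfolding card_last_residue_class[OF \<open>m > 0\<close>, symmetric]
    by (rule card_mono) auto
  have "card ((?R \<union> F) \<inter> {0..<n}) \<le> card (?R \<inter> {0..<n} \<union> F)"
    by (rule card_mono) (use \<open>finite F\<close> in auto)
  also have "\<dots> \<le> n div m + card F"
    using card_Un_le[of "?R \<inter> {0..<n}" F] card_last_residue_class[OF \<open>m > 0\<close>] by simp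
  finally have upper: "card ((?R \<union> F) \<inter> {0..<n}) \<le> n div m + card F" .
  have "real n / real m = real (n div m) + real (n mod m) / real m"
    by (rule of_nat_of_nat_div_aux)
  moreover have "real (n mod m) / real m < 1"
    using \<open>m > 0\<close> by simp
  ultimately have "real (n div m) \<le> 1 / real m * real n" "1 / real m * real n \<le> real (n div m) + 1"
    by simp_all
  then show "\<bar>real (card ((?R \<union> F) \<inter> {0..<n})) - 1 / real m * real n\<bar> \<le> real (card F) + 1"
    using lower upper by linarith
qed

lemma sophie_germain_prime_mod_6:
  assumes "sophie_germain_prime p" and "p \<noteq> 2" and "p \<noteq> 3"
  shows "p mod 6 = 5"
proof -
  have "prime p" and "prime (2 * p + 1)"
    using assms by (auto simp: sophie_germain_prime_def)
  have "p > 1"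
    using \<open>prime p\<close> by (rule prime_gt_1_nat)
  have "\<not> 2 dvd p" and "\<not> 3 dvd p"
    using \<open>prime p\<close> assms primes_dvd_imp_eq[of 2 p] primes_dvd_imp_eq[of 3 p] by auto
  moreover have "\<not> 3 dvd 2 * p + 1"
    using \<open>prime (2 * p + 1)\<close> \<open>p > 1\<close> primes_dvd_imp_eq[of 3 "2 * p + 1"] by auto
  ultimately show ?thesis
    by presburger
qed

theorem theorem9:
  shows "\<exists>S :: nat set. has_asymptotic_density S (1 / 6) \<and>
           (\<forall>p. sophie_germain_prime p \<longrightarrow> p \<in> S)"
proof (intro exI conjI allI impI)
  show "has_asymptotic_density ({k. Suc k mod 6 = 0} \<union> {2, 3}) (1 / 6)"
    using has_asymptotic_density_last_residue_class_Un_finite[of 6 "{2, 3}"] by simp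
  fix p
  assume "sophie_germain_prime p"
  then show "p \<in> {k. Suc k mod 6 = 0} \<union> {2, 3}"
    using sophie_germain_prime_mod_6[of p] by (auto simp: mod_Suc)
qed

end
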